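(* Let $F$ be a clone on a set $A$ and $F'$ a clone on a set $B$ such that the unary part $F^{(1)}$ is weakly directed. Let $\xi\colon F\to F'$ be a surjective clone homomorphism such that its restriction $F^{(1)}\to F'^{(1)}$ is given by conjugation with a bijection $\theta\colon A\to B$, i.e. $\xi(f)=\theta\circ f\circ\theta^{-1}$ for all $f\in F^{(1)}$. Then for every $n\in\mathbb{N}$ and every $h\in F^{(n)}$ we have $\xi(h)=\theta\circ h\circ(\theta^{-1}\times\cdots\times\theta^{-1})$ ($n$ factors); in particular, $\xi$ is a clone isomorphism and a uniform homeomorphism.
   Context: For $n\in\mathbb{N}$, $O_A^{(n)}=A^{A^n}$ is the set of $n$-ary operations on $A$. A clone on $A$ is a set $F\subseteq\bigcup_n O_A^{(n)}$ containing all projections $e_i^n(x_1,\dots,x_n)=x_i$ and closed under composition $f\circ(g_1,\dots,g_n)$ (with $f$ $n$-ary, $g_i$ all $m$-ary); $F^{(n)}=F\cap O_A^{(n)}$. A clone homomorphism preserves arities, projections and composition. A transformation semigroup $S\subseteq A^A$ is weakly directed if for all $a,b\in A$ there exist $f,g\in S$ and $c\in A$ with $f(c)=a$ and $g(c)=b$. Each $F^{(n)}\subseteq A^{A^n}$ carries the uniformity of pointwise convergence (basic entourages: agreement on a finite subset of $A^n$, with $A$ discrete) and $F$ carries the disjoint-union (coproduct) uniformity; a uniform homeomorphism is a bijection uniformly continuous in both directions. *)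

theory Defs
  imports Complex_Main "HOL-Library.FuncSet" "HOL-Library.NList"
begin

text \<open>
  Finitary operations on a carrier set \<open>A\<close>. The set of tuples \<open>A\<^sup>n\<close> is \<open>nlists n A\<close>; arity \<open>0\<close> is
  allowed. An operation is stored together with its arity, since for empty \<open>A\<close> the operations of
  different positive arities would otherwise coincide. Functions are extensional (\<open>undefined\<close>
  outside \<open>A\<^sup>n\<close>), so that equality of operations is equality of the represented functions.
\<close>

type_synonym 'a operation = "nat \<times> ('a list \<Rightarrow> 'a)"

abbreviation arity :: "'a operation \<Rightarrow> nat" where
  "arity f \<equiv> fst f"

abbreviation app :: "'a operation \<Rightarrow> 'a list \<Rightarrow> 'a" where
  "app f \<equiv> snd f"

definition operations :: "'a set \<Rightarrow> 'a operation set" where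
  "operations A = (SIGMA n:UNIV. nlists n A \<rightarrow>\<^sub>E A)"

text \<open>The projection \<open>projection A n i\<close>, for \<open>i < n\<close>, selects the coordinate with 0-based index \<open>i\<close>.\<close>

definition projection :: "'a set \<Rightarrow> nat \<Rightarrow> nat \<Rightarrow> 'a operation" where
  "projection A n i = (n, \<lambda>xs\<in>nlists n A. xs ! i)"

text \<open>
  The composition \<open>f \<circ> (g\<^sub>1,\<dots>,g\<^sub>n)\<close> of an \<open>n\<close>-ary \<open>f\<close> with \<open>m\<close>-ary \<open>g\<^sub>i\<close>. The arity \<open>m\<close> is an
  argument because it is not determined by the list of the \<open>g\<^sub>i\<close> when \<open>n = 0\<close>.
\<close>

definition compose_op ::
    "'a set \<Rightarrow> nat \<Rightarrow> 'a operation \<Rightarrow> 'a operation list \<Rightarrow> 'a operation" where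
  "compose_op A m f gs = (m, \<lambda>xs\<in>nlists m A. app f (map (\<lambda>g. app g xs) gs))"

definition nary_part :: "'a operation set \<Rightarrow> nat \<Rightarrow> 'a operation set" where
  "nary_part F n = {f \<in> F. arity f = n}"

definition clone :: "'a set \<Rightarrow> 'a operation set \<Rightarrow> bool" where
  "clone A F \<longleftrightarrow>
     F \<subseteq> operations A \<and>
     (\<forall>n. \<forall>i<n. projection A n i \<in> F) \<and>
     (\<forall>n m. \<forall>f\<in>nary_part F n. \<forall>gs\<in>nlists n (nary_part F m). compose_op A m f gs \<in> F)"

definition clone_hom ::
    "'a set \<Rightarrow> 'a operation set \<Rightarrow> 'b set \<Rightarrow> 'b operation set \<Rightarrow>
     ('a operation \<Rightarrow> 'b operation) \<Rightarrow> bool" where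
  "clone_hom A F B F' \<xi> \<longleftrightarrow>
     \<xi> \<in> F \<rightarrow> F' \<and>
     (\<forall>f\<in>F. arity (\<xi> f) = arity f) \<and>
     (\<forall>n. \<forall>i<n. \<xi> (projection A n i) = projection B n i) \<and>
     (\<forall>n m. \<forall>f\<in>nary_part F n. \<forall>gs\<in>nlists n (nary_part F m).
        \<xi> (compose_op A m f gs) = compose_op B m (\<xi> f) (map \<xi> gs))"

definition clone_iso ::
    "'a set \<Rightarrow> 'a operation set \<Rightarrow> 'b set \<Rightarrow> 'b operation set \<Rightarrow>
     ('a operation \<Rightarrow> 'b operation) \<Rightarrow> bool" where
  "clone_iso A F B F' \<xi> \<longleftrightarrow>
     bij_betw \<xi> F F' \<and> clone_hom A F B F' \<xi> \<and> clone_hom B F' A F (inv_into F \<xi>)"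

text \<open>The unary operations of \<open>F\<close>, read as self-maps of \<open>A\<close> (i.e. \<open>A\<^sup>1\<close> is identified with \<open>A\<close>).\<close>

definition unary_maps :: "'a set \<Rightarrow> 'a operation set \<Rightarrow> ('a \<Rightarrow> 'a) set" where
  "unary_maps A F = (\<lambda>f. \<lambda>x\<in>A. app f [x]) ` nary_part F 1"

definition weakly_directed :: "'a set \<Rightarrow> ('a \<Rightarrow> 'a) set \<Rightarrow> bool" where
  "weakly_directed A S \<longleftrightarrow> (\<forall>a\<in>A. \<forall>b\<in>A. \<exists>f\<in>S. \<exists>g\<in>S. \<exists>c\<in>A. f c = a \<and> g c = b)"

text \<open>
  \<open>conjugate A B \<theta> h\<close> is \<open>\<theta> \<circ> h \<circ> (\<theta>\<^sup>-\<^sup>1 \<times> \<dots> \<times> \<theta>\<^sup>-\<^sup>1)\<close> with as many factors as the arity of \<open>h\<close>.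
\<close>

definition conjugate ::
    "'a set \<Rightarrow> 'b set \<Rightarrow> ('a \<Rightarrow> 'b) \<Rightarrow> 'a operation \<Rightarrow> 'b operation" where
  "conjugate A B \<theta> h =
     (arity h, \<lambda>ys\<in>nlists (arity h) B. \<theta> (app h (map (inv_into A \<theta>) ys)))"

text \<open>
  Uniformities on a carrier set are given by their filters of entourages, as in the type class
  \<^class>\<open>uniform_space\<close>, whose uniformity however lives on a whole type. A uniformity on a set
  \<open>X\<close> is represented by a filter containing \<open>X \<times> X\<close>.

  The infimum is the filter generated by the basic entourages given by agreement on finite
  subsets \<open>X\<close> of \<open>A\<^sup>n\<close>.
\<close>

definition pointwise_uniformity ::
    "'a set \<Rightarrow> 'a operation set \<Rightarrow> nat \<Rightarrow> ('a operation \<times> 'a operation) filter" where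
  "pointwise_uniformity A F n =
     (INF X\<in>{X. finite X \<and> X \<subseteq> nlists n A}.
        principal {(f, g). f \<in> nary_part F n \<and> g \<in> nary_part F n \<and> (\<forall>x\<in>X. app f x = app g x)})"

text \<open>
  The coproduct uniformity: \<open>F\<close> is the disjoint union of the \<open>nary_part F n\<close>, and a set is an
  entourage iff its restriction to every \<open>nary_part F n\<close> is one, which is the supremum of filters.
\<close>

definition clone_uniformity ::
    "'a set \<Rightarrow> 'a operation set \<Rightarrow> ('a operation \<times> 'a operation) filter" where
  "clone_uniformity A F = (SUP n. pointwise_uniformity A F n)"

definition uniformly_continuous_wrt ::
    "('x \<times> 'x) filter \<Rightarrow> ('y \<times> 'y) filter \<Rightarrow> ('x \<Rightarrow> 'y) \<Rightarrow> bool" where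
  "uniformly_continuous_wrt U V f \<longleftrightarrow> (LIM (x, y) U. (f x, f y) :> V)"

definition uniform_homeomorphism ::
    "'x set \<Rightarrow> ('x \<times> 'x) filter \<Rightarrow> 'y set \<Rightarrow> ('y \<times> 'y) filter \<Rightarrow> ('x \<Rightarrow> 'y) \<Rightarrow> bool" where
  "uniform_homeomorphism X U Y V f \<longleftrightarrow>
     bij_betw f X Y \<and>
     uniformly_continuous_wrt U V f \<and>
     uniformly_continuous_wrt V U (inv_into X f)"

end

theory Submission
  imports Defs
begin

text \<open>
  Iterating weak directedness, every tuple \<open>(a\<^sub>1,\<dots>,a\<^sub>n)\<close> over a nonempty \<open>A\<close> has the form
  \<open>(f\<^sub>1 c,\<dots>,f\<^sub>n c)\<close> with unary \<open>f\<^sub>i \<in> F\<close>. The value of \<open>h\<close> at the tuple is therefore the value of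
  the unary operation \<open>h \<circ> (f\<^sub>1,\<dots>,f\<^sub>n)\<close> at \<open>c\<close>. Since \<open>\<xi>\<close> is a homomorphism and acts as conjugation
  on unary operations, it acts as conjugation on \<open>h\<close> as well. Agreement on finite sets is
  transported by conjugation in both directions.
\<close>

text \<open>As simp rules, these two send the simplifier into a loop together with \<open>nlists_def\<close>.\<close>

declare nlistsE_length [simp del] nlistsE_set [simp del]

section \<open>Clones and clone homomorphisms, arity by arity\<close>

lemma nary_part_app_in:
  assumes "clone A F" "f \<in> nary_part F n" "xs \<in> nlists n A"
  shows "app f xs \<in> A"
proof -
  have "f \<in> operations A" "arity f = n"
    using assms(1,2) by (auto simp: clone_def nary_part_def)
  then have "app f \<in> nlists n A \<rightarrow> A"
    by (auto simp: operations_def)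
  then show ?thesis using assms(3) by (rule funcset_mem)
qed

lemma nary_part_eqI:
  assumes "clone A F" "f \<in> nary_part F n" "g \<in> nary_part F n"
    and "\<And>xs. xs \<in> nlists n A \<Longrightarrow> app f xs = app g xs"
  shows "f = g"
proof -
  have "f \<in> operations A" "g \<in> operations A" "arity f = n" "arity g = n"
    using assms(1-3) by (auto simp: clone_def nary_part_def)
  then have "app f \<in> nlists n A \<rightarrow>\<^sub>E A" "app g \<in> nlists n A \<rightarrow>\<^sub>E A"
    by (auto simp: operations_def)
  then have "app f = app g"
    using assms(4) by (rule PiE_ext)
  then show ?thesis
    using \<open>arity f = n\<close> \<open>arity g = n\<close> by (simp add: prod_eq_iff)
qed

lemma compose_op_in_nary_part:
  assumes "clone A F" "f \<in> nary_part F n" "gs \<in> nlists n (nary_part F m)"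
  shows "compose_op A m f gs \<in> nary_part F m"
proof -
  have "compose_op A m f gs \<in> F"
    using assms unfolding clone_def by blast
  then show ?thesis by (simp add: nary_part_def compose_op_def)
qed

lemma app_compose_op:
  "xs \<in> nlists m A \<Longrightarrow> app (compose_op A m f gs) xs = app f (map (\<lambda>g. app g xs) gs)"
  by (simp add: compose_op_def)

lemma singleton_in_nlists [simp]: "[x] \<in> nlists 1 A \<longleftrightarrow> x \<in> A"
  by (simp add: nlists_def)

lemma clone_hom_arity: "clone_hom A F B F' \<xi> \<Longrightarrow> f \<in> F \<Longrightarrow> arity (\<xi> f) = arity f"
  unfolding clone_hom_def by blast

lemma clone_hom_compose_op:
  assumes "clone_hom A F B F' \<xi>" "f \<in> nary_part F n" "gs \<in> nlists n (nary_part F m)"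
  shows "\<xi> (compose_op A m f gs) = compose_op B m (\<xi> f) (map \<xi> gs)"
  using assms unfolding clone_hom_def by blast

lemma clone_hom_nary_part:
  assumes "clone_hom A F B F' \<xi>" "f \<in> nary_part F n"
  shows "\<xi> f \<in> nary_part F' n"
proof -
  have "\<xi> \<in> F \<rightarrow> F'"
    using assms(1) unfolding clone_hom_def by blast
  then show ?thesis
    using assms(2) clone_hom_arity[OF assms(1)] by (auto simp: nary_part_def)
qed

section \<open>Weak directedness for tuples\<close>

lemma weakly_directed_unary_mapsE:
  assumes "weakly_directed A (unary_maps A F)" "a \<in> A" "b \<in> A"
  obtains f g c where "f \<in> nary_part F 1" "g \<in> nary_part F 1" "c \<in> A"
    "app f [c] = a" "app g [c] = b"
proof -
  have "\<exists>u\<in>unary_maps A F. \<exists>v\<in>unary_maps A F. \<exists>c\<in>A. u c = a \<and> v c = b"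
    using assms unfolding weakly_directed_def by blast
  then obtain f g c where fgc: "f \<in> nary_part F 1" "g \<in> nary_part F 1" "c \<in> A"
    and "(\<lambda>x\<in>A. app f [x]) c = a" "(\<lambda>x\<in>A. app g [x]) c = b"
    unfolding unary_maps_def by blast
  then have "app f [c] = a" "app g [c] = b" by simp_all
  with fgc show thesis by (rule that)
qed

text \<open>Induction on the tuple: the common source \<open>c\<close> of the tail and the new entry
  \<open>a\<close> are two points of \<open>A\<close>, so weak directedness gives a single
  \<open>d\<close> from which both are reached.\<close>

lemma weakly_directed_tuple:
  assumes clone: "clone A F" and wd: "weakly_directed A (unary_maps A F)"
    and "A \<noteq> {}" and "set xs \<subseteq> A"
  shows "\<exists>fs\<in>nlists (length xs) (nary_part F 1). \<exists>c\<in>A. map (\<lambda>f. app f [c]) fs = xs"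
  using \<open>set xs \<subseteq> A\<close>
proof (induction xs)
  case Nil
  \<comment> \<open>The list of operations is empty here, so any element of \<open>A\<close> serves
    as \<open>c\<close>; the empty tuple cannot supply one itself.\<close>
  then show ?case using \<open>A \<noteq> {}\<close> by auto
next
  case (Cons a xs)
  then have "a \<in> A" "set xs \<subseteq> A" by simp_all
  from Cons.IH[OF \<open>set xs \<subseteq> A\<close>]
  obtain fs c where fs: "fs \<in> nlists (length xs) (nary_part F 1)" and "c \<in> A"
    and xs: "map (\<lambda>f. app f [c]) fs = xs"
    by blast
  obtain u v d where u: "u \<in> nary_part F 1" and v: "v \<in> nary_part F 1" and "d \<in> A"
    and "app u [d] = c" and "app v [d] = a"
    by (rule weakly_directed_unary_mapsE[OF wd \<open>c \<in> A\<close> \<open>a \<in> A\<close>])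
  \<comment> \<open>\<open>u\<close> sends \<open>d\<close> to \<open>c\<close>, so precomposing the
    tail operations with \<open>u\<close> moves their common source from \<open>c\<close> to
    \<open>d\<close> without changing the values; \<open>v\<close> supplies the head.\<close>
  let ?gs = "v # map (\<lambda>f. compose_op A 1 f [u]) fs"
  have "compose_op A 1 f [u] \<in> nary_part F 1" if "f \<in> set fs" for f
    using that fs u by (intro compose_op_in_nary_part[OF clone, of f 1]) (auto simp: nlists_def)
  then have "?gs \<in> nlists (length (a # xs)) (nary_part F 1)"
    using fs v by (auto simp: nlists_def)
  moreover have "map (\<lambda>f. app f [d]) ?gs = a # xs"
    using \<open>d \<in> A\<close> \<open>app u [d] = c\<close> \<open>app v [d] = a\<close> xs by (auto simp: app_compose_op)
  ultimately show ?case using \<open>d \<in> A\<close> by (intro bexI[of _ ?gs] bexI[of _ d])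
qed

section \<open>Transfer along the bijection\<close>

lemma app_conjugate:
  assumes "bij_betw \<theta> A B" "xs \<in> nlists (arity h) A"
  shows "app (conjugate A B \<theta> h) (map \<theta> xs) = \<theta> (app h xs)"
proof -
  have "map \<theta> xs \<in> nlists (arity h) B"
    using assms by (auto simp: nlists_def bij_betw_def)
  moreover have "map (inv_into A \<theta>) (map \<theta> xs) = xs"
    using assms by (auto simp: nlists_def bij_betw_def intro!: map_idI inv_into_f_f)
  ultimately show ?thesis by (simp add: conjugate_def del: map_map)
qed

text \<open>Allows points of \<open>nlists n B\<close> to be written as images under
  \<open>\<theta>\<close>, the form used in \<open>app_conjugate\<close>, so that later computations
  avoid the inverse of \<open>\<theta>\<close>.\<close>

lemma map_bij_betw_nlistsE:
  assumes "bij_betw \<theta> A B" "ys \<in> nlists n B"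
  obtains xs where "xs \<in> nlists n A" "ys = map \<theta> xs"
proof
  show "map (inv_into A \<theta>) ys \<in> nlists n A"
    using assms by (auto simp: nlists_def bij_betw_def inv_into_into)
  show "ys = map \<theta> (map (inv_into A \<theta>) ys)"
    using assms by (auto simp: nlists_def bij_betw_def f_inv_into_f subset_iff intro!: map_idI[symmetric])
qed

lemma clone_hom_app_eq:
  assumes F: "clone A F" and wd: "weakly_directed A (unary_maps A F)"
    and hom: "clone_hom A F B F' \<xi>" and \<theta>: "bij_betw \<theta> A B"
    and unary: "\<forall>f\<in>nary_part F 1. \<xi> f = conjugate A B \<theta> f"
    and h: "h \<in> nary_part F n" and xs: "xs \<in> nlists n A"
  shows "app (\<xi> h) (map \<theta> xs) = \<theta> (app h xs)"
proof -
  \<comment> \<open>For \<open>n = 0\<close> the tuple \<open>xs\<close> has no entries; it is the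
    value of \<open>h\<close> that provides an element of \<open>A\<close>.\<close>
  have "A \<noteq> {}" using nary_part_app_in[OF F h xs] by blast
  then obtain fs c where fs: "fs \<in> nlists n (nary_part F 1)" and c: "c \<in> A"
    and fsc: "map (\<lambda>f. app f [c]) fs = xs"
    using weakly_directed_tuple[OF F wd, of xs] xs by (auto simp: nlists_def)
  have app_unary: "app (\<xi> f) [\<theta> c] = \<theta> (app f [c])" if "f \<in> nary_part F 1" for f
  proof -
    have "[c] \<in> nlists (arity f) A" using that c by (simp add: nary_part_def)
    from app_conjugate[OF \<theta> this] show ?thesis using unary that by simp
  qed
  have "\<theta> c \<in> B" using \<theta> c by (auto simp: bij_betw_def)
  \<comment> \<open>The image tuple is again represented by unary operations at one point, now the
    \<open>\<xi> f\<close> at \<open>\<theta> c\<close>; this turns the value of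
    \<open>\<xi> h\<close> into that of a composition.\<close>
  have "map \<theta> xs = map (\<lambda>g. app g [\<theta> c]) (map \<xi> fs)"
    using fs by (auto simp: fsc[symmetric] nlists_def app_unary subset_iff)
  then have "app (\<xi> h) (map \<theta> xs) = app (compose_op B 1 (\<xi> h) (map \<xi> fs)) [\<theta> c]"
    using \<open>\<theta> c \<in> B\<close> by (simp add: app_compose_op)
  also have "\<dots> = app (\<xi> (compose_op A 1 h fs)) [\<theta> c]"
    by (simp only: clone_hom_compose_op[OF hom h fs])
  \<comment> \<open>The composition with \<open>fs\<close> is unary although \<open>h\<close> has
    arbitrary arity, so the conjugation hypothesis applies to it.\<close>
  also have "\<dots> = \<theta> (app (compose_op A 1 h fs) [c])"
    by (intro app_unary compose_op_in_nary_part[OF F h fs])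
  also have "\<dots> = \<theta> (app h xs)"
    using c fsc by (simp add: app_compose_op)
  finally show ?thesis .
qed

section \<open>Inverses of bijective homomorphisms\<close>

text \<open>For projections and compositions, \<open>\<xi>\<close> maps the side of the law lying in
  \<open>F\<close> to the argument of \<open>?\<eta>\<close>; cancelling with
  \<open>\<eta>\<xi>\<close> gives the law for the inverse.\<close>

lemma clone_iso_if_bij_betw:
  assumes F: "clone A F" and hom: "clone_hom A F B F' \<xi>" and bij: "bij_betw \<xi> F F'"
  shows "clone_iso A F B F' \<xi>"
proof -
  let ?\<eta> = "inv_into F \<xi>"
  have in_F: "?\<eta> f \<in> F" and \<xi>\<eta>: "\<xi> (?\<eta> f) = f" if "f \<in> F'" for f
    using that bij by (auto simp: bij_betw_def inv_into_into f_inv_into_f)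
  have \<eta>\<xi>: "?\<eta> (\<xi> f) = f" if "f \<in> F" for f
    using that bij by (simp add: bij_betw_def)
  have arity: "arity (?\<eta> f) = arity f" if "f \<in> F'" for f
    using clone_hom_arity[OF hom in_F[OF that]] \<xi>\<eta>[OF that] by simp
  have nary: "?\<eta> f \<in> nary_part F n" if "f \<in> nary_part F' n" for f n
    using that in_F arity by (auto simp: nary_part_def)
  have proj: "?\<eta> (projection B n i) = projection A n i" if "i < n" for n i
  proof -
    have "projection A n i \<in> F" "\<xi> (projection A n i) = projection B n i"
      using that F hom by (auto simp: clone_def clone_hom_def)
    then show ?thesis using \<eta>\<xi> by metis
  qed
  have comp: "?\<eta> (compose_op B m f gs) = compose_op A m (?\<eta> f) (map ?\<eta> gs)"
    if f: "f \<in> nary_part F' n" and gs: "gs \<in> nlists n (nary_part F' m)" for n m f gs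
  proof -
    have gs': "map ?\<eta> gs \<in> nlists n (nary_part F m)"
      using gs nary by (auto simp: nlists_def)
    have "map \<xi> (map ?\<eta> gs) = gs"
      using gs by (auto simp: nlists_def nary_part_def \<xi>\<eta> subset_iff intro!: map_idI)
    moreover have "\<xi> (?\<eta> f) = f" using f by (simp add: nary_part_def \<xi>\<eta>)
    ultimately have "\<xi> (compose_op A m (?\<eta> f) (map ?\<eta> gs)) = compose_op B m f gs"
      using clone_hom_compose_op[OF hom nary[OF f] gs'] by simp
    moreover have "compose_op A m (?\<eta> f) (map ?\<eta> gs) \<in> F"
      using compose_op_in_nary_part[OF F nary[OF f] gs'] by (simp add: nary_part_def)
    ultimately show ?thesis using \<eta>\<xi> by metis
  qed
  have "clone_hom B F' A F ?\<eta>"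
    unfolding clone_hom_def using in_F arity proj comp by blast
  with hom bij show ?thesis by (simp add: clone_iso_def)
qed

section \<open>Uniform continuity from pointwise dependence\<close>

text \<open>
  The hypothesis \<open>local\<close> says that the value of \<open>\<phi> f\<close> at a point depends only on the value of \<open>f\<close>
  at a single point, which is chosen independently of \<open>f\<close>.
\<close>

lemma uniformly_continuous_wrt_clone_uniformityI:
  assumes nary: "\<And>n f. f \<in> nary_part F n \<Longrightarrow> \<phi> f \<in> nary_part F' n"
    and "local": "\<And>n y. y \<in> nlists n B \<Longrightarrow> \<exists>x\<in>nlists n A. \<forall>f\<in>nary_part F n. \<forall>g\<in>nary_part F n.
      app f x = app g x \<longrightarrow> app (\<phi> f) y = app (\<phi> g) y"
  shows "uniformly_continuous_wrt (clone_uniformity A F) (clone_uniformity B F') \<phi>"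
proof -
  let ?\<phi> = "\<lambda>(f, g). (\<phi> f, \<phi> g)"
  have "filterlim ?\<phi> (pointwise_uniformity B F' n) (pointwise_uniformity A F n)" for n
    unfolding pointwise_uniformity_def[of B] filterlim_INF filterlim_principal
  proof (intro ballI)
    fix Y assume "Y \<in> {Y. finite Y \<and> Y \<subseteq> nlists n B}"
    then have Y: "finite Y" "Y \<subseteq> nlists n B" by simp_all
    let ?E = "\<lambda>X. {(f, g). f \<in> nary_part F n \<and> g \<in> nary_part F n \<and> (\<forall>x\<in>X. app f x = app g x)}"
    let ?E' = "{(f, g). f \<in> nary_part F' n \<and> g \<in> nary_part F' n \<and> (\<forall>y\<in>Y. app f y = app g y)}"
    \<comment> \<open>\<open>p\<close> picks one controlling point for each \<open>y\<close>. The
      image of the finite set \<open>Y\<close> under \<open>p\<close> is finite and defines the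
      basic entourage that is mapped into \<open>?E'\<close>.\<close>
    from "local"[of _ n] have "\<forall>y\<in>nlists n B. \<exists>x. x \<in> nlists n A \<and> (\<forall>f\<in>nary_part F n. \<forall>g\<in>nary_part F n.
      app f x = app g x \<longrightarrow> app (\<phi> f) y = app (\<phi> g) y)"
      by blast
    from bchoice[OF this] obtain p where p: "\<And>y. y \<in> nlists n B \<Longrightarrow> p y \<in> nlists n A"
      and p_local: "\<And>y f g. \<lbrakk>y \<in> nlists n B; f \<in> nary_part F n; g \<in> nary_part F n;
        app f (p y) = app g (p y)\<rbrakk> \<Longrightarrow> app (\<phi> f) y = app (\<phi> g) y"
      by blast
    have "finite (p ` Y) \<and> p ` Y \<subseteq> nlists n A" using Y p by blast
    then have "pointwise_uniformity A F n \<le> principal (?E (p ` Y))"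
      unfolding pointwise_uniformity_def by (intro INF_lower) simp
    moreover have "?\<phi> fg \<in> ?E'" if "fg \<in> ?E (p ` Y)" for fg
    proof -
      obtain f g where "fg = (f, g)" by (rule prod.exhaust)
      with that have fg: "fg = (f, g)" "f \<in> nary_part F n" "g \<in> nary_part F n"
        "\<And>y. y \<in> Y \<Longrightarrow> app f (p y) = app g (p y)"
        by simp_all
      then have "app (\<phi> f) y = app (\<phi> g) y" if "y \<in> Y" for y
        using p_local that Y by blast
      then show ?thesis using fg nary by simp
    qed
    then have "eventually (\<lambda>fg. ?\<phi> fg \<in> ?E') (principal (?E (p ` Y)))"
      unfolding eventually_principal by (rule ballI)
    ultimately show "eventually (\<lambda>fg. ?\<phi> fg \<in> ?E') (pointwise_uniformity A F n)"
      by (rule filter_leD)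
  qed
  \<comment> \<open>The image of a supremum of filters is the supremum of the images, so continuity
    on each arity separately suffices.\<close>
  then show ?thesis
    unfolding uniformly_continuous_wrt_def clone_uniformity_def filterlim_def filtermap_SUP
    by (intro SUP_mono) blast
qed

section \<open>Conjugation in all arities, isomorphism and uniform homeomorphism\<close>

theorem theorem4p3:
  fixes A :: "'a set" and B :: "'b set"
    and F :: "'a operation set" and F' :: "'b operation set"
    and \<xi> :: "'a operation \<Rightarrow> 'b operation" and \<theta> :: "'a \<Rightarrow> 'b"
  assumes "clone A F" and "clone B F'"
    and "weakly_directed A (unary_maps A F)"
    and "clone_hom A F B F' \<xi>" and "\<xi> ` F = F'"
    and "bij_betw \<theta> A B"
    and "\<forall>f\<in>nary_part F 1. \<xi> f = conjugate A B \<theta> f"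
  shows "(\<forall>n. \<forall>h\<in>nary_part F n. \<xi> h = conjugate A B \<theta> h) \<and>
    clone_iso A F B F' \<xi> \<and>
    uniform_homeomorphism F (clone_uniformity A F) F' (clone_uniformity B F') \<xi>"
proof -
  note F = assms(1) and F' = assms(2) and hom = assms(4) and surj = assms(5) and \<theta> = assms(6)
  note app_\<xi> = clone_hom_app_eq[OF F assms(3) hom \<theta> assms(7)]
  have inj_\<theta>: "\<theta> a = \<theta> b \<longleftrightarrow> a = b" if "a \<in> A" "b \<in> A" for a b
    using that \<theta> by (auto simp: bij_betw_def inj_on_def)
  \<comment> \<open>This equivalence yields the injectivity of \<open>\<xi>\<close> and, read in its
    two directions, the uniform continuity of \<open>\<xi>\<close> and of its inverse.\<close>
  have app_\<xi>_eq_iff: "app (\<xi> f) (map \<theta> xs) = app (\<xi> g) (map \<theta> xs) \<longleftrightarrow> app f xs = app g xs"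
    if "f \<in> nary_part F n" "g \<in> nary_part F n" "xs \<in> nlists n A" for f g n xs
    using that by (simp add: app_\<xi> inj_\<theta> nary_part_app_in[OF F])
  have map_\<theta>: "map \<theta> xs \<in> nlists n B" if "xs \<in> nlists n A" for n xs
    using that \<theta> by (auto simp: nlists_def bij_betw_def)

  have conj: "\<xi> h = conjugate A B \<theta> h" if h: "h \<in> nary_part F n" for n h
  proof -
    have ar: "arity h = n" "arity (\<xi> h) = n" and "\<xi> h \<in> operations B"
      using h clone_hom_nary_part[OF hom h] F' by (auto simp: nary_part_def clone_def)
    \<comment> \<open>Both functions are \<open>undefined\<close> outside \<open>nlists n B\<close>,
      so only tuples over \<open>B\<close> remain to be compared, and these are images under
      \<open>\<theta>\<close>.\<close>
    then have "app (\<xi> h) \<in> extensional (nlists n B)"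
      by (auto simp: operations_def PiE_def)
    moreover have "app (conjugate A B \<theta> h) \<in> extensional (nlists n B)"
      by (simp add: conjugate_def ar)
    moreover have "app (\<xi> h) ys = app (conjugate A B \<theta> h) ys" if "ys \<in> nlists n B" for ys
      using map_bij_betw_nlistsE[OF \<theta> that] app_\<xi>[OF h] app_conjugate[OF \<theta>, of _ h] ar by metis
    ultimately have "app (\<xi> h) = app (conjugate A B \<theta> h)"
      by (rule extensionalityI)
    then show ?thesis using ar by (simp add: prod_eq_iff conjugate_def)
  qed

  have "inj_on \<xi> F"
  proof (rule inj_onI)
    fix f g assume "f \<in> F" "g \<in> F" and eq: "\<xi> f = \<xi> g"
    \<comment> \<open>Since \<open>\<xi>\<close> preserves arities, \<open>f\<close> and
      \<open>g\<close> can be compared on the same tuples.\<close>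
    then have "arity f = arity g" using clone_hom_arity[OF hom] by metis
    then have fg: "f \<in> nary_part F (arity f)" "g \<in> nary_part F (arity f)"
      using \<open>f \<in> F\<close> \<open>g \<in> F\<close> by (auto simp: nary_part_def)
    then show "f = g"
      using nary_part_eqI[OF F fg] app_\<xi>_eq_iff[OF fg] eq by simp
  qed
  with surj have bij: "bij_betw \<xi> F F'" by (simp add: bij_betw_def)
  with F hom have iso: "clone_iso A F B F' \<xi>" by (rule clone_iso_if_bij_betw)

  let ?\<eta> = "inv_into F \<xi>"
  have \<eta>_hom: "clone_hom B F' A F ?\<eta>" using iso by (simp add: clone_iso_def)
  have "uniformly_continuous_wrt (clone_uniformity A F) (clone_uniformity B F') \<xi>"
  proof (rule uniformly_continuous_wrt_clone_uniformityI)
    fix n ys assume "ys \<in> nlists n B"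
    \<comment> \<open>The controlling point for \<open>ys\<close> is its preimage under
      \<open>\<theta>\<close>, whatever the operations are.\<close>
    then obtain xs where "xs \<in> nlists n A" "ys = map \<theta> xs"
      by (rule map_bij_betw_nlistsE[OF \<theta>])
    then show "\<exists>x\<in>nlists n A. \<forall>f\<in>nary_part F n. \<forall>g\<in>nary_part F n.
        app f x = app g x \<longrightarrow> app (\<xi> f) ys = app (\<xi> g) ys"
      using app_\<xi>_eq_iff by blast
  qed (rule clone_hom_nary_part[OF hom])
  moreover have "uniformly_continuous_wrt (clone_uniformity B F') (clone_uniformity A F) ?\<eta>"
  proof (rule uniformly_continuous_wrt_clone_uniformityI)
    fix n xs assume xs: "xs \<in> nlists n A"
    \<comment> \<open>For the inverse the controlling point is
      \<open>map \<theta> xs\<close>.\<close>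
    have "app (?\<eta> f) xs = app (?\<eta> g) xs"
      if "f \<in> nary_part F' n" "g \<in> nary_part F' n" "app f (map \<theta> xs) = app g (map \<theta> xs)" for f g
    proof -
      have "\<xi> (?\<eta> f) = f" "\<xi> (?\<eta> g) = g"
        using that surj by (auto simp: nary_part_def f_inv_into_f)
      then show ?thesis
        using app_\<xi>_eq_iff[of "?\<eta> f" n "?\<eta> g" xs] that xs clone_hom_nary_part[OF \<eta>_hom] by simp
    qed
    then show "\<exists>y\<in>nlists n B. \<forall>f\<in>nary_part F' n. \<forall>g\<in>nary_part F' n.
        app f y = app g y \<longrightarrow> app (?\<eta> f) xs = app (?\<eta> g) xs"
      using map_\<theta>[OF xs] by blast
  qed (rule clone_hom_nary_part[OF \<eta>_hom])
  ultimately show ?thesis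
    using conj iso bij by (simp add: uniform_homeomorphism_def)
qed

end
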